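(* Consider a ring network with $J$ nodes and $2J$ classes of connections: for $1\le j\le J$, class $j$ uses the two nodes $j$ and $j+1$ (indices modulo $J$), and class $0j$ uses only node $j$. If the functions $\beta_k$, $k\in\{1,\dots,J\}\cup\{01,\dots,0J\}$, are Lipschitz, continuously differentiable, non-decreasing, and each $\beta_k$ depends only on the sum of the utilizations of the nodes used by class $k$, then there exists a unique solution $u\in\mathbb{R}_+^J$ of the fixed point equation $$u_j=\phi_{0j}(u_j)+\phi_{j-1}(u_{j-1}+u_j)+\phi_j(u_j+u_{j+1}),\qquad 1\le j\le J.$$
   Context: $\mathbb{R}_+=[0,\infty)$; all node indices are understood modulo $J$; $u_j$ is the utilization of node $j$. The allocation coefficient is $1$ if a class uses a node and $0$ otherwise. For each class $k\in\{1,\dots,J\}\cup\{01,\dots,0J\}$, $p_k$ is the proportion of class $k$ connections ($\sum_k p_k=1$), $a_k$ is a non-negative number (linear increase rate), $r_k\in(0,1)$ is the multiplicative decrease factor, and $\beta_k$ is the loss rate function; since it depends only on the sum of the utilizations of the nodes used by class $k$, it is regarded as a function $\beta_k:\mathbb{R}_+\to\mathbb{R}_+$ of that sum. The function $\phi_k$ is $$\phi_k(s)=p_k\sqrt{\frac{2}{\pi}}\left(\prod_{n=1}^{\infty}\frac{1-r_k^{2n}}{1-r_k^{2n-1}}\right)\sqrt{\frac{a_k}{\beta_k(s)}}.$$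
   Formalization: The formal statement assumes each φ_k is finite somewhere, excluding β_k identically 0 with p_k a_k > 0, where φ_k is undefined everywhere; where β_k vanishes and p_k a_k > 0, φ_k is read as +∞, and φ_k is 0 if p_k or a_k is 0. *)

theory Defs
  imports "HOL-Analysis.Analysis"
begin

text \<open>
  Nodes are numbered \<open>1, \<dots>, J\<close>. \<open>Link j\<close> is the class written \<open>j\<close> in the usual
  notation (it uses nodes \<open>j\<close> and \<open>j + 1\<close>), and \<open>Local j\<close> is the class written \<open>0j\<close>
  (it uses node \<open>j\<close> only).
\<close>

datatype ring_class = Link nat | Local nat

definition ring_classes :: "nat \<Rightarrow> ring_class set" where
  "ring_classes J = Link ` {1..J} \<union> Local ` {1..J}"

text \<open>Indices modulo \<open>J\<close>, with representatives \<open>1, \<dots>, J\<close> (so that \<open>0\<close> is \<open>J\<close>).\<close>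

definition next_node :: "nat \<Rightarrow> nat \<Rightarrow> nat" where
  "next_node J j = (if j = J then 1 else j + 1)"

definition prev_node :: "nat \<Rightarrow> nat \<Rightarrow> nat" where
  "prev_node J j = (if j = 1 then J else j - 1)"

text \<open>
  The derivative at the left endpoint \<open>0\<close> is one-sided; the values of \<open>f\<close> at negative
  arguments play no role.
\<close>

definition C1_on_nonneg :: "(real \<Rightarrow> real) \<Rightarrow> bool" where
  "C1_on_nonneg f \<longleftrightarrow>
     (\<exists>f'. (\<forall>x\<ge>0. (f has_real_derivative f' x) (at x within {0..})) \<and> continuous_on {0..} f')"

text \<open>
  A loss rate may vanish, for instance at \<open>0\<close>. Since \<open>x / 0 = 0\<close> on the reals,
  \<open>sqrt (a / b)\<close> would then be \<open>0\<close>, whereas the intended value for \<open>a > 0\<close> is \<open>\<infinity>\<close>.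
\<close>

definition sqrt_ratio :: "real \<Rightarrow> real \<Rightarrow> ennreal" where
  "sqrt_ratio a b = (if b = 0 \<and> a > 0 then \<infinity> else ennreal (sqrt (a / b)))"

text \<open>
  The index of the product is shifted by one: the factor at \<open>n\<close> is the one with exponents
  \<open>2 (n + 1)\<close> and \<open>2 (n + 1) - 1\<close>.
\<close>

definition phi :: "real \<Rightarrow> real \<Rightarrow> real \<Rightarrow> (real \<Rightarrow> real) \<Rightarrow> real \<Rightarrow> ennreal" where
  "phi p a r \<beta> s =
     ennreal (p * sqrt (2 / pi) * (\<Prod>n. (1 - r ^ (2 * n + 2)) / (1 - r ^ (2 * n + 1))))
     * sqrt_ratio a (\<beta> s)"

end

theory Submission
  imports Defs
begin

text \<open>Let \<open>A k i\<close> count how often class k uses node i, so that class k carries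
  the load (A u)_k. The ring equations then read u = A^T \<phi>(A u). For real-valued continuous
  non-increasing rates this says that the gradient of a strictly convex potential vanishes, namely
  of |u|^2/2 - sum_k G_k((A u)_k) with G_k' = \<phi>_k.

  Existence: for bounded continuous rates the potential attains a minimum on a large cube, and the
  signs of its partial derivatives there give the equation
  (\<open>bounded_fixed_point_exists\<close>). The actual rates may be infinite where \<beta>_k
  vanishes. At a fixed point, however, the rate of a class that uses some node never exceeds its
  load, so it suffices to have truncations that agree with the rates wherever value \<le> argument
  (\<open>fixed_point_exists\<close>, \<open>phi_truncation\<close>). Such truncations are built for
  rates that are finite somewhere; a rate infinite everywhere would admit no solution.

  Uniqueness: the rates are antitone (\<open>phi_antimono\<close>), so u - A^T \<phi>(A u) is
  strongly monotone (\<open>fixed_point_unique\<close>). Finally \<open>sum_ring_usage\<close>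
  identifies the ring system with the general form.\<close>

section \<open>Loads of the classes\<close>

definition load :: "('k \<Rightarrow> 'i \<Rightarrow> nat) \<Rightarrow> 'i set \<Rightarrow> 'k \<Rightarrow> ('i \<Rightarrow> real) \<Rightarrow> real" where
  "load A I k u = (\<Sum>i\<in>I. real (A k i) * u i)"

lemma load_nonneg:
  assumes "u \<in> I \<rightarrow>\<^sub>E {0..}"
  shows "0 \<le> load A I k u"
  unfolding load_def using assms by (intro sum_nonneg) (auto simp: PiE_iff)

lemma mult_le_load:
  assumes "finite I" "u \<in> I \<rightarrow>\<^sub>E {0..}" "i \<in> I"
  shows "real (A k i) * u i \<le> load A I k u"
  unfolding load_def using assms by (intro member_le_sum) (auto simp: PiE_iff)

lemma load_fun_upd:
  assumes "finite I" "i \<in> I"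
  shows "load A I k (u(i := x)) = load A I k u + real (A k i) * (x - u i)"
  using assms unfolding load_def
  by (simp add: sum.remove[of I i] algebra_simps)

section \<open>One-variable calculus and compactness of cubes\<close>

text \<open>Integrating from -1 makes 0 an interior point, so the derivative is two-sided even at
  load 0.\<close>

lemma antiderivative_exists_nonneg:
  fixes g :: "real \<Rightarrow> real"
  assumes "continuous_on UNIV g"
  shows "\<exists>G. \<forall>x\<ge>0. (G has_real_derivative g x) (at x)"
proof (intro exI allI impI)
  fix x :: real
  assume "0 \<le> x"
  then have "((\<lambda>y. integral {-1..y} g) has_real_derivative g x) (at x within {-1..x+1})"
    by (intro integral_has_real_derivative continuous_on_subset[OF assms]) auto
  then show "((\<lambda>y. integral {-1..y} g) has_real_derivative g x) (at x)"
    using \<open>0 \<le> x\<close> by (simp add: at_within_Icc_at)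
qed

text \<open>With the wrong sign of \<open>D\<close>, a short step that stays in the interval would
  lower \<open>f\<close>. At an endpoint only one of the two signs is available.\<close>

lemma DERIV_at_min_on_Icc:
  fixes f :: "real \<Rightarrow> real"
  assumes "(f has_real_derivative D) (at x)" "a \<le> x" "x \<le> b"
    and min: "\<And>y. a \<le> y \<Longrightarrow> y \<le> b \<Longrightarrow> f x \<le> f y"
  shows "x < b \<Longrightarrow> 0 \<le> D" "a < x \<Longrightarrow> D \<le> 0"
proof -
  show "0 \<le> D" if "x < b"
  proof (rule ccontr)
    assume "\<not> 0 \<le> D"
    then obtain d where d: "d > 0" "\<And>h. 0 < h \<Longrightarrow> h < d \<Longrightarrow> f (x + h) < f x"
      using DERIV_neg_dec_right[OF assms(1)] by (auto simp: not_le)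
    define h where "h = min (d / 2) (b - x)"
    have "0 < h" "h < d" "x + h \<le> b"
      using d(1) that by (auto simp: h_def min_def)
    then show False
      using d(2)[of h] min[of "x + h"] assms(2) by auto
  qed
  show "D \<le> 0" if "a < x"
  proof (rule ccontr)
    assume "\<not> D \<le> 0"
    then obtain d where d: "d > 0" "\<And>h. 0 < h \<Longrightarrow> h < d \<Longrightarrow> f (x - h) < f x"
      using DERIV_pos_inc_left[OF assms(1)] by (auto simp: not_le)
    define h where "h = min (d / 2) (x - a)"
    have "0 < h" "h < d" "a \<le> x - h"
      using d(1) that by (auto simp: h_def min_def)
    then show False
      using d(2)[of h] min[of "x - h"] assms(3) by auto
  qed
qed

text \<open>Extensional functions form a full product with factor \<open>{undefined}\<close> off
  \<open>I\<close>, so Tychonoff's theorem applies.\<close>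

lemma compact_PiE_real:
  fixes S :: "real set"
  assumes "compact S"
  shows "compact (I \<rightarrow>\<^sub>E S :: ('i \<Rightarrow> real) set)"
proof -
  let ?T = "\<lambda>i. if i \<in> I then S else {undefined}"
  have "I \<rightarrow>\<^sub>E S = PiE UNIV ?T"
    by (auto simp: PiE_iff extensional_def split: if_splits)
  moreover have "compactin (product_topology (\<lambda>i. euclidean) UNIV) (PiE UNIV ?T)"
    using assms by (simp add: compactin_PiE)
  ultimately show ?thesis
    by (metis compactin_euclidean_iff euclidean_product_topology)
qed

section \<open>Existence\<close>

text \<open>The fixed points are the critical points of
  \<open>\<Sum>i. u i\<^sup>2 / 2 - \<Sum>k. G k (load A I k u)\<close> with \<open>G k\<close> a primitive of \<open>g k\<close>.\<close>

lemma bounded_fixed_point_exists: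
  fixes A :: "'k \<Rightarrow> 'i \<Rightarrow> nat" and g :: "'k \<Rightarrow> real \<Rightarrow> real"
  assumes fin: "finite I" "finite K"
    and cont: "\<And>k. k \<in> K \<Longrightarrow> continuous_on UNIV (g k)"
    and nonneg: "\<And>k s. k \<in> K \<Longrightarrow> 0 \<le> g k s"
    and bound: "\<And>k s. k \<in> K \<Longrightarrow> g k s \<le> B k"
  shows "\<exists>u\<in>I \<rightarrow>\<^sub>E {0..}. \<forall>i\<in>I. u i = (\<Sum>k\<in>K. real (A k i) * g k (load A I k u))"
proof -
  have "\<forall>k\<in>K. \<exists>G. \<forall>x\<ge>0. (G has_real_derivative g k x) (at x)"
    using antiderivative_exists_nonneg cont by blast
  then obtain G where G: "\<And>k x. k \<in> K \<Longrightarrow> 0 \<le> x \<Longrightarrow> (G k has_real_derivative g k x) (at x)"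
    by metis
  have B: "0 \<le> B k" if "k \<in> K" for k
    using nonneg[OF that, of 0] bound[OF that, of 0] by linarith
  \<comment> \<open>The summand 1 makes the right-hand side strictly less than \<open>M\<close>,
    which rules out a minimum on an upper face.\<close>
  define M where "M = 1 + (\<Sum>i\<in>I. \<Sum>k\<in>K. real (A k i) * B k)"
  have M: "(\<Sum>k\<in>K. real (A k i) * g k (load A I k u)) < M" if "i \<in> I" for i u
  proof -
    have "(\<Sum>k\<in>K. real (A k i) * g k (load A I k u)) \<le> (\<Sum>k\<in>K. real (A k i) * B k)"
      by (intro sum_mono mult_left_mono bound) auto
    also have "\<dots> \<le> (\<Sum>i\<in>I. \<Sum>k\<in>K. real (A k i) * B k)"
      using that fin B by (intro member_le_sum[where f="\<lambda>i. \<Sum>k\<in>K. real (A k i) * B k"] sum_nonneg) auto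
    finally show ?thesis
      by (simp add: M_def)
  qed
  have "M \<ge> 0"
    unfolding M_def using B by (intro add_nonneg_nonneg sum_nonneg) auto
  define F where "F u = (\<Sum>i\<in>I. (u i)\<^sup>2 / 2) - (\<Sum>k\<in>K. G k (load A I k u))" for u
  let ?Box = "I \<rightarrow>\<^sub>E {0..M}"
  have Box: "?Box \<subseteq> I \<rightarrow>\<^sub>E {0..}"
    by (auto simp: PiE_iff)
  have cont_coord: "continuous_on ?Box (\<lambda>u. u i)" for i
    by (rule continuous_on_subset[OF continuous_on_product_coordinates]) auto
  have "continuous_on ?Box (\<lambda>u. G k (load A I k u))" if "k \<in> K" for k
  proof (rule continuous_on_compose2[where g="G k" and f="load A I k" and t="{0..}"])
    show "continuous_on {0..} (G k)"
      using G[OF that] by (intro continuous_at_imp_continuous_on) (auto intro: DERIV_isCont)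
    show "continuous_on ?Box (load A I k)"
      unfolding load_def by (intro continuous_intros cont_coord)
    show "load A I k ` ?Box \<subseteq> {0..}"
      using subsetD[OF Box] by (auto intro: load_nonneg)
  qed
  then have "continuous_on ?Box F"
    unfolding F_def by (intro continuous_intros cont_coord) auto
  moreover have "?Box \<noteq> {}"
    using \<open>M \<ge> 0\<close> by (simp add: PiE_eq_empty_iff)
  ultimately obtain u where u: "u \<in> ?Box" and min: "\<And>v. v \<in> ?Box \<Longrightarrow> F u \<le> F v"
    using continuous_attains_inf[of ?Box F] compact_PiE_real[of "{0..M}" I] by blast
  have "u i = (\<Sum>k\<in>K. real (A k i) * g k (load A I k u))" (is "_ = ?R") if "i \<in> I" for i
  proof -
    have ui: "0 \<le> u i" "u i \<le> M"
      using u that by (auto simp: PiE_iff)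
    \<comment> \<open>When only coordinate \<open>i\<close> varies, load \<open>k\<close> moves with
      slope \<open>A k i\<close>; hence the partial derivative of \<open>F\<close> is the residual
      \<open>u i - ?R\<close>.\<close>
    have F_upd: "F (u(i := x)) = x\<^sup>2 / 2 + (\<Sum>j\<in>I - {i}. (u j)\<^sup>2 / 2)
        - (\<Sum>k\<in>K. G k (load A I k u + real (A k i) * (x - u i)))" for x
      using fin that by (simp add: F_def load_fun_upd sum.remove[of I i])
    have "((\<lambda>x. G k (load A I k u + real (A k i) * (x - u i))) has_real_derivative
        real (A k i) * g k (load A I k u)) (at (u i))" if "k \<in> K" for k
    proof -
      have "(G k has_real_derivative g k (load A I k u))
          (at (load A I k u + real (A k i) * (u i - u i)))"
        using G[OF that load_nonneg[OF subsetD[OF Box u]], of A k] by simp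
      then show ?thesis
        by (rule DERIV_chain2[THEN DERIV_cong]) (auto intro!: derivative_eq_intros)
    qed
    moreover have "((\<lambda>x. x\<^sup>2 / 2 + (\<Sum>j\<in>I - {i}. (u j)\<^sup>2 / 2)) has_real_derivative u i) (at (u i))"
      by (auto intro!: derivative_eq_intros)
    ultimately have "((\<lambda>x. F (u(i := x))) has_real_derivative (u i - ?R)) (at (u i))"
      unfolding F_upd by (intro DERIV_diff DERIV_sum)
    moreover have "F (u(i := u i)) \<le> F (u(i := y))" if "0 \<le> y" "y \<le> M" for y
      using u \<open>i \<in> I\<close> that by (auto intro!: min simp: PiE_iff extensional_def)
    ultimately have "u i < M \<Longrightarrow> 0 \<le> u i - ?R" "0 < u i \<Longrightarrow> u i - ?R \<le> 0"
      using DERIV_at_min_on_Icc[of "\<lambda>x. F (u(i := x))" "u i - ?R" "u i" 0 M, OF _ ui] by simp_all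
    moreover have "0 \<le> ?R"
      by (intro sum_nonneg mult_nonneg_nonneg nonneg) auto
    \<comment> \<open>If \<open>u i = M\<close>, then \<open>M \<le> ?R\<close>, a contradiction. If
      \<open>u i = 0\<close>, then \<open>?R \<le> 0\<close>, so both are 0. Otherwise both signs
      hold.\<close>
    ultimately show "u i = ?R"
      using ui M[OF that, of u] by linarith
  qed
  then show ?thesis
    using u Box by blast
qed

lemma fixed_point_exists:
  fixes A :: "'k \<Rightarrow> 'i \<Rightarrow> nat" and \<phi> :: "'k \<Rightarrow> real \<Rightarrow> ennreal"
  assumes fin: "finite I" "finite K"
    and trunc: "\<And>k. k \<in> K \<Longrightarrow> \<exists>g B. continuous_on UNIV g \<and> (\<forall>s. 0 \<le> g s \<and> g s \<le> B) \<and>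
      (\<forall>s\<ge>0. g s \<le> s \<longrightarrow> \<phi> k s = ennreal (g s))"
  shows "\<exists>u\<in>I \<rightarrow>\<^sub>E {0..}. \<forall>i\<in>I. ennreal (u i) = (\<Sum>k\<in>K. of_nat (A k i) * \<phi> k (load A I k u))"
proof -
  obtain g B where g: "\<And>k. k \<in> K \<Longrightarrow> continuous_on UNIV (g k)"
    "\<And>k s. k \<in> K \<Longrightarrow> 0 \<le> g k s" "\<And>k s. k \<in> K \<Longrightarrow> g k s \<le> B k"
    "\<And>k s. k \<in> K \<Longrightarrow> 0 \<le> s \<Longrightarrow> g k s \<le> s \<Longrightarrow> \<phi> k s = ennreal (g k s)"
    using trunc by metis
  obtain u where u: "u \<in> I \<rightarrow>\<^sub>E {0..}"
    and eq: "\<And>i. i \<in> I \<Longrightarrow> u i = (\<Sum>k\<in>K. real (A k i) * g k (load A I k u))"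
    using bounded_fixed_point_exists[of I K g B A, OF fin g(1-3)] by auto
  have "ennreal (u i) = (\<Sum>k\<in>K. of_nat (A k i) * \<phi> k (load A I k u))" if "i \<in> I" for i
  proof -
    have "ennreal (real (A k i) * g k (load A I k u)) = of_nat (A k i) * \<phi> k (load A I k u)"
      if "k \<in> K" for k
    \<comment> \<open>For \<open>A k i = 0\<close> both sides are 0 even at an infinite rate.
      Otherwise \<open>A k i\<close> is at least 1, and the chain below bounds the truncated rate by
      the load, where it agrees with \<open>\<phi> k\<close>.\<close>
    proof (cases "A k i = 0")
      case False
      then have A: "1 \<le> real (A k i)"
        by simp
      have "g k (load A I k u) \<le> real (A k i) * g k (load A I k u)"
        using mult_right_mono[OF A g(2)[OF \<open>k \<in> K\<close>]] by simp
      also have "\<dots> \<le> u i"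
        unfolding eq[OF \<open>i \<in> I\<close>] using fin g(2) \<open>k \<in> K\<close>
        by (intro member_le_sum[where f="\<lambda>k. real (A k i) * g k (load A I k u)"]) auto
      also have "\<dots> \<le> real (A k i) * u i"
        using mult_right_mono[OF A, of "u i"] u \<open>i \<in> I\<close> by (auto simp: PiE_iff)
      also have "\<dots> \<le> load A I k u"
        using mult_le_load fin(1) u \<open>i \<in> I\<close> .
      finally show ?thesis
        using g(2)[OF \<open>k \<in> K\<close>] g(4)[OF \<open>k \<in> K\<close> load_nonneg[OF u, of A k]]
        by (simp add: ennreal_mult ennreal_of_nat_eq_real_of_nat)
    qed simp
    then show ?thesis
      unfolding eq[OF that] using g(2) by (subst sum_ennreal[symmetric]) auto
  qed
  then show ?thesis
    using u by blast
qed

section \<open>Uniqueness\<close>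

text \<open>For two solutions \<open>u\<close>, \<open>v\<close>, pairing the equations with \<open>u - v\<close> gives
  \<open>\<Sum>i. (u i - v i)\<^sup>2 = \<Sum>k. (x k - y k) * (\<phi> k (x k) - \<phi> k (y k)) \<le> 0\<close>, where \<open>x\<close>, \<open>y\<close> are the loads.\<close>

lemma fixed_point_unique:
  fixes A :: "'k \<Rightarrow> 'i \<Rightarrow> nat" and \<phi> :: "'k \<Rightarrow> real \<Rightarrow> ennreal"
  assumes fin: "finite I" "finite K"
    and anti: "\<And>k. k \<in> K \<Longrightarrow> antimono_on {0..} (\<phi> k)"
    and u: "u \<in> I \<rightarrow>\<^sub>E {0..}" "\<And>i. i \<in> I \<Longrightarrow> ennreal (u i) = (\<Sum>k\<in>K. of_nat (A k i) * \<phi> k (load A I k u))"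
    and v: "v \<in> I \<rightarrow>\<^sub>E {0..}" "\<And>i. i \<in> I \<Longrightarrow> ennreal (v i) = (\<Sum>k\<in>K. of_nat (A k i) * \<phi> k (load A I k v))"
  shows "u = v"
proof -
  define f where "f k w = enn2real (\<phi> k (load A I k w))" for k w
  have real: "w i = (\<Sum>k\<in>K. real (A k i) * f k w)"
    and finite_rate: "\<And>k. k \<in> K \<Longrightarrow> A k i \<noteq> 0 \<Longrightarrow> \<phi> k (load A I k w) < top"
    if w: "w \<in> I \<rightarrow>\<^sub>E {0..}" "ennreal (w i) = (\<Sum>k\<in>K. of_nat (A k i) * \<phi> k (load A I k w))"
      and "i \<in> I" for w i
  proof -
    have top: "of_nat (A k i) * \<phi> k (load A I k w) < top" if "k \<in> K" for k
      using w(2) fin(2) that by (metis ennreal_less_top ennreal_sum_less_top)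
    have "w i = enn2real (ennreal (w i))"
      using w(1) \<open>i \<in> I\<close> by (auto simp: PiE_iff)
    also have "\<dots> = (\<Sum>k\<in>K. enn2real (of_nat (A k i) * \<phi> k (load A I k w)))"
      unfolding w(2) using top by (simp add: enn2real_sum)
    also have "\<dots> = (\<Sum>k\<in>K. real (A k i) * f k w)"
      by (simp add: f_def enn2real_mult)
    finally show "w i = (\<Sum>k\<in>K. real (A k i) * f k w)" .
    show "\<phi> k (load A I k w) < top" if "k \<in> K" "A k i \<noteq> 0" for k
      using top[OF that(1)] that(2) by (auto simp: ennreal_mult_less_top)
  qed
  have "(\<Sum>i\<in>I. (u i - v i)\<^sup>2) = (\<Sum>i\<in>I. \<Sum>k\<in>K. real (A k i) * (u i - v i) * (f k u - f k v))"
  proof (rule sum.cong[OF refl])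
    fix i assume "i \<in> I"
    have "u i - v i = (\<Sum>k\<in>K. real (A k i) * (f k u - f k v))"
      using real[OF u(1) u(2)] real[OF v(1) v(2)] \<open>i \<in> I\<close>
      by (simp add: sum_subtractf right_diff_distrib)
    then have "(u i - v i)\<^sup>2 = (u i - v i) * (\<Sum>k\<in>K. real (A k i) * (f k u - f k v))"
      by (simp add: power2_eq_square)
    then show "(u i - v i)\<^sup>2 = (\<Sum>k\<in>K. real (A k i) * (u i - v i) * (f k u - f k v))"
      by (simp add: sum_distrib_left mult_ac)
  qed
  also have "\<dots> = (\<Sum>k\<in>K. (load A I k u - load A I k v) * (f k u - f k v))"
    by (subst sum.swap) (simp add: load_def sum_subtractf[symmetric] sum_distrib_right right_diff_distrib)
  also have "\<dots> \<le> 0"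
  proof (rule sum_nonpos)
    fix k assume k: "k \<in> K"
    show "(load A I k u - load A I k v) * (f k u - f k v) \<le> 0"
    \<comment> \<open>\<open>enn2real\<close> sends \<open>top\<close> to 0, so it respects the
      order only at finite rates. The equation at a node used by \<open>k\<close> gives finiteness;
      a class using no node has load 0 in both solutions.\<close>
    proof (cases "\<exists>i\<in>I. A k i \<noteq> 0")
      case True
      then have fin_uv: "\<phi> k (load A I k u) < top" "\<phi> k (load A I k v) < top"
        using finite_rate u v k by blast+
      have "f k w \<le> f k w'" if "load A I k w' \<le> load A I k w" "\<phi> k (load A I k w') < top"
        "w \<in> I \<rightarrow>\<^sub>E {0..}" "w' \<in> I \<rightarrow>\<^sub>E {0..}" for w w'
        unfolding f_def using that
        by (intro enn2real_mono monotone_onD[OF anti[OF k]]) (auto intro: load_nonneg)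
      then show ?thesis
        using fin_uv u(1) v(1) by (cases "load A I k u \<le> load A I k v") (auto simp: mult_le_0_iff)
    qed (simp add: load_def)
  qed
  finally have "(\<Sum>i\<in>I. (u i - v i)\<^sup>2) = 0"
    by (meson antisym sum_nonneg zero_le_power2)
  then have "\<And>i. i \<in> I \<Longrightarrow> u i = v i"
    using fin(1) by (simp add: sum_nonneg_eq_0_iff)
  then show ?thesis
    using u(1) v(1) by (rule PiE_ext[rotated 2])
qed

section \<open>Monotonicity and truncation of the rate functions\<close>

text \<open>The value \<infinity> at a vanishing loss rate with \<open>a > 0\<close> preserves
  monotonicity there; real division by zero would break it.\<close>

lemma phi_antimono:
  assumes "\<And>s. 0 \<le> s \<Longrightarrow> 0 \<le> \<beta> s" "mono_on {0..} \<beta>" "0 \<le> a"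
  shows "antimono_on {0..} (phi p a r \<beta>)"
proof (rule monotone_onI)
  fix s t :: real
  assume st: "s \<in> {0..}" "t \<in> {0..}" "s \<le> t"
  have "sqrt_ratio a (\<beta> t) \<le> sqrt_ratio a (\<beta> s)"
  proof (cases "\<beta> s = 0")
    case False
    then have "0 < \<beta> s" "\<beta> s \<le> \<beta> t"
      using assms(1)[of s] monotone_onD[OF assms(2) st] st by auto
    then show ?thesis
      using assms(3) by (auto simp: sqrt_ratio_def intro!: ennreal_leI divide_left_mono)
  qed (use assms(3) in \<open>auto simp: sqrt_ratio_def\<close>)
  then show "phi p a r \<beta> t \<le> phi p a r \<beta> s"
    unfolding phi_def by (intro mult_left_mono) auto
qed

text \<open>At a fixed point, the argument of each rate function is at least its value.
  The truncation level is so high that such arguments lie in the region where the rate is finite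
  and the truncation is inactive.\<close>

lemma phi_truncation:
  assumes \<beta>: "\<And>s. 0 \<le> s \<Longrightarrow> 0 \<le> \<beta> s" "mono_on {0..} \<beta>" "continuous_on {0..} \<beta>"
    and "0 \<le> a"
    and finite: "\<exists>s\<ge>0. phi p a r \<beta> s \<noteq> \<infinity>"
  shows "\<exists>g B. continuous_on UNIV g \<and> (\<forall>s. 0 \<le> g s \<and> g s \<le> B) \<and>
    (\<forall>s\<ge>0. g s \<le> s \<longrightarrow> phi p a r \<beta> s = ennreal (g s))"
proof -
  define C where "C = p * sqrt (2 / pi) * (\<Prod>n. (1 - r ^ (2 * n + 2)) / (1 - r ^ (2 * n + 1)))"
  have phi: "phi p a r \<beta> s = ennreal C * sqrt_ratio a (\<beta> s)" for s
    by (simp add: phi_def C_def)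
  show ?thesis
  \<comment> \<open>The infinite product is never evaluated: \<open>ennreal\<close> turns a
    nonpositive \<open>C\<close> into 0.\<close>
  proof (cases "C \<le> 0 \<or> a = 0")
    case True
    then have "phi p a r \<beta> s = 0" for s
      by (auto simp: phi sqrt_ratio_def ennreal_neg)
    then show ?thesis
      by (intro exI[of _ "\<lambda>_. 0"] exI[of _ 0]) auto
  next
    case False
    then have C: "0 < C" and a: "0 < a"
      using \<open>0 \<le> a\<close> by auto
    obtain t where t: "0 \<le> t" "phi p a r \<beta> t \<noteq> \<infinity>"
      using finite by blast
    then have "\<beta> t \<noteq> 0"
      using C a by (auto simp: phi sqrt_ratio_def ennreal_mult_eq_top_iff)
    then have "0 < \<beta> t"
      using \<beta>(1)[OF t(1)] by simp
    \<comment> \<open>The second bound puts the cap \<open>C * sqrt (a / \<delta>)\<close> above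
      \<open>t\<close>. So if the cap is active at \<open>s\<close> and \<open>g s \<le> s\<close>,
      then \<open>t \<le> s\<close>, and monotonicity with the first bound gives
      \<open>\<delta> \<le> \<beta> s\<close>, a contradiction.\<close>
    define \<delta> where "\<delta> = min (\<beta> t) (a * C\<^sup>2 / (t + 1)\<^sup>2)"
    have \<delta>: "0 < \<delta>" "\<delta> \<le> \<beta> t" "\<delta> \<le> a * C\<^sup>2 / (t + 1)\<^sup>2"
      using \<open>0 < \<beta> t\<close> a C t(1) by (auto simp: \<delta>_def)
    have "((t + 1) / C)\<^sup>2 \<le> a / \<delta>"
      using \<delta> C t(1) by (simp add: field_simps power_divide)
    then have "(t + 1) / C \<le> sqrt (a / \<delta>)"
      by (rule real_le_rsqrt)
    then have level: "t + 1 \<le> C * sqrt (a / \<delta>)"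
      using C by (simp add: field_simps)
    define g where "g s = C * sqrt (a / max (\<beta> (max 0 s)) \<delta>)" for s
    have "continuous_on UNIV (\<lambda>s. \<beta> (max 0 s))"
      by (rule continuous_on_compose2[OF \<beta>(3)]) (auto intro!: continuous_intros)
    then have "continuous_on UNIV g"
      unfolding g_def using \<delta>(1) by (intro continuous_intros) (auto simp: max_def)
    moreover have "0 \<le> g s \<and> g s \<le> C * sqrt (a / \<delta>)" for s
      using C a \<delta>(1) by (auto simp: g_def intro!: divide_left_mono mult_pos_pos)
    moreover have "phi p a r \<beta> s = ennreal (g s)" if "0 \<le> s" "g s \<le> s" for s
    proof (cases "\<delta> \<le> \<beta> s")
      case True
      then show ?thesis
        using that(1) C a \<delta>(1) by (auto simp: phi g_def sqrt_ratio_def ennreal_mult max_def)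
    next
      case False
      then have "t \<le> s"
        using that level by (auto simp: g_def max_def)
      then have "\<beta> t \<le> \<beta> s"
        using monotone_onD[OF \<beta>(2)] t(1) that(1) by auto
      then show ?thesis
        using False \<delta>(2) by linarith
    qed
    ultimately show ?thesis
      by blast
  qed
qed

section \<open>The ring as an instance\<close>

text \<open>Multiplicities matter for \<open>J = 1\<close>, where both end nodes of \<open>Link 1\<close> are node \<open>1\<close>.\<close>

fun ring_usage :: "nat \<Rightarrow> ring_class \<Rightarrow> nat \<Rightarrow> nat" where
  "ring_usage J (Local j) i = of_bool (i = j)"
| "ring_usage J (Link j) i = of_bool (i = j) + of_bool (i = next_node J j)"

lemma next_node_in: "j \<in> {1..J} \<Longrightarrow> next_node J j \<in> {1..J}"
  by (auto simp: next_node_def)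

lemma prev_node_in: "j \<in> {1..J} \<Longrightarrow> prev_node J j \<in> {1..J}"
  by (auto simp: prev_node_def)

lemma eq_next_node_iff:
  "i \<in> {1..J} \<Longrightarrow> j \<in> {1..J} \<Longrightarrow> i = next_node J j \<longleftrightarrow> j = prev_node J i"
  by (auto simp: next_node_def prev_node_def)

lemma next_prev_node: "j \<in> {1..J} \<Longrightarrow> next_node J (prev_node J j) = j"
  by (auto simp: next_node_def prev_node_def)

lemma load_ring:
  assumes "j \<in> {1..J}"
  shows "load (ring_usage J) {1..J} (Local j) u = u j"
    and "load (ring_usage J) {1..J} (Link j) u = u j + u (next_node J j)"
  using assms next_node_in[OF assms]
  by (simp_all add: load_def distrib_right sum.distrib of_bool_def if_distrib[of real]
      if_distrib[of "\<lambda>x. x * _"] cong: if_cong)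

lemma finite_ring_classes: "finite (ring_classes J)"
  by (simp add: ring_classes_def)

lemma sum_ring_classes:
  fixes f :: "ring_class \<Rightarrow> 'a::comm_monoid_add"
  shows "(\<Sum>k\<in>ring_classes J. f k) = (\<Sum>j\<in>{1..J}. f (Local j)) + (\<Sum>j\<in>{1..J}. f (Link j))"
  unfolding ring_classes_def
  by (subst sum.union_disjoint) (auto simp: sum.reindex inj_on_def add.commute)

text \<open>\<open>next_node\<close> and \<open>prev_node\<close> are mutually inverse, so node
  \<open>i\<close> is the second end of exactly one link. For \<open>J = 1\<close> that link is
  \<open>Link i\<close> itself, and both sides count it twice.\<close>

lemma sum_ring_usage:
  fixes \<phi> :: "ring_class \<Rightarrow> real \<Rightarrow> ennreal"
  assumes "i \<in> {1..J}"
  shows "(\<Sum>k\<in>ring_classes J. of_nat (ring_usage J k i) * \<phi> k (load (ring_usage J) {1..J} k u)) =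
    \<phi> (Local i) (u i) + \<phi> (Link (prev_node J i)) (u (prev_node J i) + u i)
      + \<phi> (Link i) (u i + u (next_node J i))"
proof -
  have delta: "(\<Sum>j\<in>{1..J}. of_bool (j = m) * f j) = f m" if "m \<in> {1..J}" for m and f :: "nat \<Rightarrow> ennreal"
    using that by (simp add: of_bool_def if_distrib[of "\<lambda>x. x * _"] cong: if_cong)
  have "(\<Sum>j\<in>{1..J}. of_nat (ring_usage J (Local j) i) * \<phi> (Local j) (load (ring_usage J) {1..J} (Local j) u)) =
      (\<Sum>j\<in>{1..J}. of_bool (j = i) * \<phi> (Local j) (u j))"
    by (intro sum.cong) (auto simp only: load_ring ring_usage.simps of_nat_of_bool eq_commute[of i])
  moreover have "(\<Sum>j\<in>{1..J}. of_nat (ring_usage J (Link j) i) * \<phi> (Link j) (load (ring_usage J) {1..J} (Link j) u)) =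
      (\<Sum>j\<in>{1..J}. of_bool (j = i) * \<phi> (Link j) (u j + u (next_node J j)))
      + (\<Sum>j\<in>{1..J}. of_bool (j = prev_node J i) * \<phi> (Link j) (u j + u (next_node J j)))"
    unfolding sum.distrib[symmetric]
    by (intro sum.cong) (auto simp: load_ring eq_next_node_iff[OF assms] distrib_right simp del: One_nat_def)
  ultimately show ?thesis
    unfolding sum_ring_classes delta[OF assms] delta[OF prev_node_in[OF assms]]
    using assms by (simp add: next_prev_node add_ac)
qed

theorem proposition7:
  fixes J :: nat
    and p a r :: "ring_class \<Rightarrow> real"
    and \<beta> :: "ring_class \<Rightarrow> real \<Rightarrow> real"
    and \<phi> :: "ring_class \<Rightarrow> real \<Rightarrow> ennreal"
  defines "\<phi> \<equiv> \<lambda>k. phi (p k) (a k) (r k) (\<beta> k)"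
  assumes "J \<ge> 1"
    and "\<And>k. k \<in> ring_classes J \<Longrightarrow> 0 \<le> p k"
    and "(\<Sum>k\<in>ring_classes J. p k) = 1"
    and "\<And>k. k \<in> ring_classes J \<Longrightarrow> 0 \<le> a k"
    and "\<And>k. k \<in> ring_classes J \<Longrightarrow> 0 < r k \<and> r k < 1"
    and "\<And>k s. k \<in> ring_classes J \<Longrightarrow> 0 \<le> s \<Longrightarrow> 0 \<le> \<beta> k s"
    and "\<And>k. k \<in> ring_classes J \<Longrightarrow> \<exists>L. L-lipschitz_on {0..} (\<beta> k)"
    and "\<And>k. k \<in> ring_classes J \<Longrightarrow> C1_on_nonneg (\<beta> k)"
    and "\<And>k. k \<in> ring_classes J \<Longrightarrow> mono_on {0..} (\<beta> k)"
    and "\<And>k. k \<in> ring_classes J \<Longrightarrow> \<exists>s\<ge>0. \<phi> k s \<noteq> \<infinity>"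
  shows "\<exists>!u. u \<in> {1..J} \<rightarrow>\<^sub>E {0..} \<and>
           (\<forall>j\<in>{1..J}. ennreal (u j) =
              \<phi> (Local j) (u j)
              + \<phi> (Link (prev_node J j)) (u (prev_node J j) + u j)
              + \<phi> (Link j) (u j + u (next_node J j)))"
proof -
  let ?A = "ring_usage J" and ?I = "{1..J}" and ?K = "ring_classes J"
  let ?sol = "\<lambda>u. u \<in> ?I \<rightarrow>\<^sub>E {0..} \<and>
    (\<forall>i\<in>?I. ennreal (u i) = (\<Sum>k\<in>?K. of_nat (?A k i) * \<phi> k (load ?A ?I k u)))"
  have "continuous_on {0..} (\<beta> k)" if "k \<in> ?K" for k
    using assms(8)[OF that] lipschitz_on_continuous_on by blast
  then have "\<exists>g B. continuous_on UNIV g \<and> (\<forall>s. 0 \<le> g s \<and> g s \<le> B) \<and>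
      (\<forall>s\<ge>0. g s \<le> s \<longrightarrow> \<phi> k s = ennreal (g s))" if "k \<in> ?K" for k
    using assms(5,7,10,11)[OF that] that unfolding \<phi>_def by (intro phi_truncation) auto
  then obtain u where u: "?sol u"
    using fixed_point_exists[of ?I ?K \<phi> ?A] finite_ring_classes by auto
  have "antimono_on {0..} (\<phi> k)" if "k \<in> ?K" for k
    using assms(5,7,10)[OF that] unfolding \<phi>_def by (intro phi_antimono) auto
  then have unique: "v = u" if "?sol v" for v
    using fixed_point_unique[of ?I ?K \<phi> v ?A u] finite_ring_classes u that by auto
  have "\<exists>!u. ?sol u"
    using u unique by (rule ex1I)
  then show ?thesis
    by (simp only: sum_ring_usage cong: ball_cong)
qed

end
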